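(* Let $\mathfrak g$ be a finite-dimensional real nilpotent Lie algebra endowed with an integrable complex structure, with $\dim\mathfrak g\ge 6$. Then $$\dim\mathfrak g-\dim\mathfrak g^4=\dim\mathfrak g-\dim\bigl[\mathfrak g,[\mathfrak g,[\mathfrak g,\mathfrak g]]\bigr]\ge 5 .$$
   Context: The descending central series of a Lie algebra $\mathfrak g$ is $\mathfrak g^1=\mathfrak g$, $\mathfrak g^k=[\mathfrak g,\mathfrak g^{k-1}]$ for $k\ge2$. An integrable complex structure on a real Lie algebra $\mathfrak g$ is a linear endomorphism $J$ of $\mathfrak g$ with $J^2=-1$ and $[JX,JY]=[X,Y]+J[JX,Y]+J[X,JY]$ for all $X,Y\in\mathfrak g$. *)

theory Defs
  imports "HOL-Analysis.Analysis"
begin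

(* A real Lie algebra is given by a real vector space type 'a (the whole type is the
   underlying space) and a bracket br on it. *)

definition finite_dimensional :: "'a::real_vector itself \<Rightarrow> bool" where
  "finite_dimensional _ \<longleftrightarrow> (\<exists>B::'a set. finite B \<and> span B = UNIV)"

locale real_lie_algebra =
  fixes br :: "'a::real_vector \<Rightarrow> 'a \<Rightarrow> 'a"
  assumes bilinear_br: "bilinear br"
    and br_self: "br x x = 0"
    and jacobi: "br x (br y z) + br y (br z x) + br z (br x y) = 0"

(* [A, B] is the linear span of all brackets, not just the set of brackets. *)
definition bracket_span :: "('a::real_vector \<Rightarrow> 'a \<Rightarrow> 'a) \<Rightarrow> 'a set \<Rightarrow> 'a set \<Rightarrow> 'a set" where
  "bracket_span br A B = span {br x y | x y. x \<in> A \<and> y \<in> B}"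

(* Numbering starts at 1, g^1 = g; the value at 0 is only a convention. *)
fun lower_central :: "('a::real_vector \<Rightarrow> 'a \<Rightarrow> 'a) \<Rightarrow> nat \<Rightarrow> 'a set" where
  "lower_central br 0 = UNIV"
| "lower_central br (Suc 0) = UNIV"
| "lower_central br (Suc (Suc k)) = bracket_span br UNIV (lower_central br (Suc k))"

definition nilpotent_lie :: "('a::real_vector \<Rightarrow> 'a \<Rightarrow> 'a) \<Rightarrow> bool" where
  "nilpotent_lie br \<longleftrightarrow> (\<exists>k\<ge>1. lower_central br k = {0})"

definition integrable_complex_structure ::
    "('a::real_vector \<Rightarrow> 'a \<Rightarrow> 'a) \<Rightarrow> ('a \<Rightarrow> 'a) \<Rightarrow> bool" where
  "integrable_complex_structure br J \<longleftrightarrow>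
     linear J \<and> (\<forall>x. J (J x) = - x) \<and>
     (\<forall>x y. br (J x) (J y) = br x y + J (br (J x) y) + J (br x (J y)))"

end

theory Submission
  imports Defs
begin

text \<open>
  Write \<open>K k = g\<^sup>k + J g\<^sup>k\<close>. Integrability gives \<open>[K k, K k] \<subseteq> K (k + 1)\<close> and shows that the
  operator \<open>ad x + J ad (J x)\<close> is complex linear, so that it maps \<open>K k\<close> into \<open>K (k + 1)\<close>. The first
  fact and nilpotency force \<open>K 2 \<noteq> g\<close>. If the codimension of \<open>g\<^sup>4\<close> were at most 4, the successive
  quotients of the series would therefore start with the dimensions 2, 1, 1, and \<open>g\<^sup>2 = K 2\<close> would
  be \<open>J\<close>-invariant, while \<open>g\<^sup>3\<close> would not be, so that \<open>K 3 = g\<^sup>2\<close>. Choosing \<open>x \<notin> g\<^sup>2\<close>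
  such that \<open>ad (J x)\<close> maps \<open>g\<^sup>2\<close> into \<open>g\<^sup>4\<close>, the two facts yield by induction \<open>K k = g\<^sup>2\<close> for
  all \<open>k \<ge> 3\<close>, hence \<open>g\<^sup>2 = 0\<close> and \<open>dim g \<le> 4\<close>.
\<close>

section \<open>Dimension of subspaces\<close>

text \<open>Turns the hypothesis on the type into a basis, which opens the theory of
  \<open>finite_dimensional_vector_space\<close>; the next three lemmas go through it.\<close>

lemma finite_dimensional_basis:
  assumes "finite_dimensional TYPE('a::real_vector)"
  obtains B :: "'a::real_vector set" where "finite_dimensional_vector_space scaleR B"
proof -
  obtain C :: "'a set" where C: "finite C" "span C = UNIV"
    using assms by (auto simp: finite_dimensional_def)
  obtain B where B: "B \<subseteq> C" "independent B" "C \<subseteq> span B"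
    using maximal_independent_subset[of C] by blast
  have "UNIV \<subseteq> span B"
    using B(3) C(2) by (metis span_mono span_span)
  moreover have "finite B"
    using B(1) C(1) finite_subset by blast
  ultimately have "finite_dimensional_vector_space scaleR B"
    using B(2) by unfold_locales (auto simp: dependent_raw_def span_raw_def)
  then show thesis
    by (rule that)
qed

lemma dim_insert_finite_dimensional:
  fixes S :: "'a::real_vector set"
  assumes "finite_dimensional TYPE('a)" "subspace S" "x \<notin> S"
  shows "dim (span (insert x S)) = dim S + 1"
proof -
  obtain B :: "'a set" where "finite_dimensional_vector_space scaleR B"
    by (rule finite_dimensional_basis[OF assms(1)])
  from finite_dimensional_vector_space.dim_insert[OF this, of x S, folded dim_raw_def span_raw_def]
  show ?thesis
    using assms(2,3) by (simp add: dim_span span_eq_iff[THEN iffD2])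
qed

lemma subspace_dim_equal_finite_dimensional:
  fixes S T :: "'a::real_vector set"
  assumes "finite_dimensional TYPE('a)" "subspace S" "subspace T" "S \<subseteq> T" "dim T \<le> dim S"
  shows "S = T"
proof -
  obtain B :: "'a set" where "finite_dimensional_vector_space scaleR B"
    by (rule finite_dimensional_basis[OF assms(1)])
  from finite_dimensional_vector_space.subspace_dim_equal[OF this, of S T]
  show ?thesis
    using assms(2-5) by (simp add: dim_raw_def subspace_raw_def)
qed

lemma dim_subset_finite_dimensional:
  fixes S T :: "'a::real_vector set"
  assumes "finite_dimensional TYPE('a)" "S \<subseteq> T"
  shows "dim S \<le> dim T"
proof -
  obtain B :: "'a set" where "finite_dimensional_vector_space scaleR B"
    by (rule finite_dimensional_basis[OF assms(1)])
  from finite_dimensional_vector_space.dim_subset[OF this, of S T]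
  show ?thesis
    using assms(2) by (simp add: dim_raw_def)
qed

lemma subspace_eq_span_insert:
  fixes S T :: "'a::real_vector set"
  assumes "finite_dimensional TYPE('a)" "subspace S" "subspace T" "S \<subset> T" "dim T \<le> dim S + 1"
  obtains z where "z \<in> T" "z \<notin> S" "T = span (insert z S)"
proof -
  obtain z where z: "z \<in> T" "z \<notin> S"
    using assms(4) by auto
  have "span (insert z S) \<subseteq> T"
    using assms(3,4) z(1) by (intro span_minimal) auto
  moreover have "dim T \<le> dim (span (insert z S))"
    using dim_insert_finite_dimensional[OF assms(1,2) z(2)] assms(5) by simp
  ultimately have "span (insert z S) = T"
    by (intro subspace_dim_equal_finite_dimensional assms(1,3)) auto
  with z show thesis
    by (intro that) auto
qed

lemma span_insertE:
  assumes "subspace S" "y \<in> span (insert z S)"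
  obtains c s where "y = c *\<^sub>R z + s" "s \<in> S"
proof -
  obtain c where "y - c *\<^sub>R z \<in> span S"
    using assms(2) by (auto simp: span_insert)
  moreover have "span S = S"
    using assms(1) by (simp add: span_eq_iff)
  ultimately show thesis
    by (intro that[of c "y - c *\<^sub>R z"]) auto
qed

section \<open>The lower central series and the second derived algebra\<close>

context real_lie_algebra
begin

abbreviation g :: "nat \<Rightarrow> 'a set" where
  "g \<equiv> lower_central br"

lemma linear_br_right: "linear (br x)"
  using bilinear_br by (simp add: bilinear_def)

lemma linear_br_left: "linear (\<lambda>x. br x y)"
  using bilinear_br by (simp add: bilinear_def)

lemmas br_simps =
  linear_add[OF linear_br_right] linear_diff[OF linear_br_right] linear_neg[OF linear_br_right]
  linear_scale[OF linear_br_right] linear_0[OF linear_br_right]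
  linear_add[OF linear_br_left] linear_diff[OF linear_br_left] linear_neg[OF linear_br_left]
  linear_scale[OF linear_br_left] linear_0[OF linear_br_left]

lemma br_swap: "br y x = - br x y"
proof -
  have "br x y + br y x = 0"
    using br_self[of "x + y"] br_self[of x] br_self[of y] by (simp add: br_simps add.commute)
  then show ?thesis
    by (simp add: eq_neg_iff_add_eq_0 add.commute)
qed

lemma br_br: "br (br x y) z = br x (br y z) - br y (br x z)"
proof -
  have "br z (br x y) = - br (br x y) z" "br y (br z x) = - br y (br x z)"
    using br_swap[of z "br x y"] br_swap[of z x] by (simp_all add: br_simps)
  then show ?thesis
    using jacobi[of x y z] by (simp add: algebra_simps eq_diff_eq)
qed

lemma subspace_br_left: "subspace V \<Longrightarrow> subspace {x. br x y \<in> V}"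
  using linear_subspace_vimage[OF linear_br_left] by (simp add: vimage_def)

lemma subspace_br_right: "subspace V \<Longrightarrow> subspace {y. br x y \<in> V}"
  using linear_subspace_vimage[OF linear_br_right] by (simp add: vimage_def)

lemma subspace_bracket_span: "subspace (bracket_span br A B)"
  by (simp add: bracket_span_def)

lemma subspace_lower_central: "subspace (g k)"
  by (cases "(br, k)" rule: lower_central.cases) (auto simp: bracket_span_def)

lemma br_mem_bracket_span: "x \<in> A \<Longrightarrow> y \<in> B \<Longrightarrow> br x y \<in> bracket_span br A B"
  by (auto simp: bracket_span_def intro!: span_base)

lemma lower_central_Suc: "1 \<le> k \<Longrightarrow> g (Suc k) = bracket_span br UNIV (g k)"
  by (cases k) auto

lemma br_mem_lower_central: "1 \<le> k \<Longrightarrow> s \<in> g k \<Longrightarrow> br x s \<in> g (Suc k)"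
  by (simp add: lower_central_Suc br_mem_bracket_span)

lemma br_mem_lower_central': "1 \<le> k \<Longrightarrow> s \<in> g k \<Longrightarrow> br s x \<in> g (Suc k)"
  using br_swap[of s x] br_mem_lower_central[of k s x]
  by (simp add: subspace_neg subspace_lower_central)

lemma lower_central_Suc_least:
  assumes "1 \<le> k" "subspace V" "\<And>x s. s \<in> g k \<Longrightarrow> br x s \<in> V"
  shows "g (Suc k) \<subseteq> V"
  unfolding lower_central_Suc[OF assms(1)] bracket_span_def
  using assms(2,3) by (intro span_minimal) auto

lemma lower_central_Suc_subset: "g (Suc k) \<subseteq> g k"
proof (induction k)
  case (Suc k)
  show ?case
  proof (cases "k = 0")
    case False
    then show ?thesis
      using Suc br_mem_lower_central[of k]
      by (intro lower_central_Suc_least subspace_lower_central) auto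
  qed auto
qed auto

lemma lower_central_antimono: "i \<le> j \<Longrightarrow> g j \<subseteq> g i"
  using lift_Suc_antimono_le[of g, OF lower_central_Suc_subset] by auto

text \<open>By \<open>br_br\<close>, a generator \<open>br x y\<close> of \<open>g 2\<close> acts as
  the commutator of two inner derivations, and each of these raises the index by one.\<close>

lemma br_lower_central_2:
  assumes "p \<in> g 2" "1 \<le> k" "s \<in> g k"
  shows "br p s \<in> g (k + 2)"
proof -
  have "g (Suc 1) \<subseteq> {p. br p s \<in> g (k + 2)}"
  proof (rule lower_central_Suc_least)
    show "subspace {p. br p s \<in> g (k + 2)}"
      by (intro subspace_br_left subspace_lower_central)
  next
    fix x y
    have "br x (br y s) \<in> g (k + 2)" "br y (br x s) \<in> g (k + 2)"
      using assms(2,3) br_mem_lower_central[of k s] br_mem_lower_central[of "Suc k"] by auto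
    then show "br x y \<in> {p. br p s \<in> g (k + 2)}"
      using subspace_diff[OF subspace_lower_central] by (simp only: br_br mem_Collect_eq)
  qed auto
  with assms(1) show ?thesis
    by (auto simp: numeral_2_eq_2)
qed

text \<open>The second derived algebra. It serves as an error term: \<open>br_shift_two\<close>
  works modulo \<open>R\<close>.\<close>

abbreviation R :: "'a set" where
  "R \<equiv> bracket_span br (g 2) (g 2)"

text \<open>Inner derivations obey the Leibniz rule and preserve \<open>g 2\<close>, so
  \<open>R\<close> is an ideal.\<close>

lemma br_R:
  assumes "r \<in> R"
  shows "br x r \<in> R"
proof -
  have step: "br x c \<in> g 2" if "c \<in> g 2" for c
    using that br_mem_lower_central[of 2 c x] lower_central_Suc_subset[of 2] by auto
  have "br x (br a b) \<in> R" if "a \<in> g 2" "b \<in> g 2" for a b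
  proof -
    have "br x (br a b) = br (br x a) b + br a (br x b)"
      by (simp add: br_br)
    then show ?thesis
      using that step by (simp add: subspace_add subspace_bracket_span br_mem_bracket_span)
  qed
  then have "span {br a b | a b. a \<in> g 2 \<and> b \<in> g 2} \<subseteq> {r. br x r \<in> R}"
    by (intro span_minimal subspace_br_right subspace_bracket_span) auto
  with assms show ?thesis
    by (auto simp: bracket_span_def)
qed

lemma br_span_lower_central_Un_R:
  assumes "1 \<le> k" "v \<in> span (g k \<union> R)"
  shows "br x v \<in> span (g (Suc k) \<union> R)"
proof -
  have "g k \<union> R \<subseteq> {v. br x v \<in> span (g (Suc k) \<union> R)}"
    using br_mem_lower_central[OF assms(1)] br_R[of _ x] by (blast intro: span_base)
  then have "span (g k \<union> R) \<subseteq> {v. br x v \<in> span (g (Suc k) \<union> R)}"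
    by (intro span_minimal subspace_br_right subspace_span)
  with assms(2) show ?thesis by auto
qed

text \<open>Modulo \<open>R\<close>, elements of \<open>g 2\<close> act trivially on \<open>g 2\<close>, so \<open>br y\<close> commutes there with all inner
  derivations, so that its shift of the series by two propagates from \<open>g 2\<close> to all \<open>g j\<close>.\<close>

lemma br_shift_two:
  assumes "\<And>s. s \<in> g 2 \<Longrightarrow> br y s \<in> g 4" "2 \<le> j" "s \<in> g j"
  shows "br y s \<in> span (g (j + 2) \<union> R)"
  using assms(2,3)
proof (induction j arbitrary: s rule: dec_induct)
  case base
  then show ?case
    using assms(1) by (auto intro: span_base)
next
  case (step j)
  have "g (Suc j) \<subseteq> {t. br y t \<in> span (g (Suc j + 2) \<union> R)}"
  proof (rule lower_central_Suc_least)
    show "subspace ({t. br y t \<in> span (g (Suc j + 2) \<union> R)})"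
      by (intro subspace_br_right subspace_span)
  next
    fix x t
    assume t: "t \<in> g j"
    have "br y x \<in> g 2"
      using br_mem_lower_central[of 1 x y] by (simp add: numeral_2_eq_2)
    moreover have "t \<in> g 2"
      using t step.hyps lower_central_antimono[of 2 j] by auto
    ultimately have "br (br y x) t \<in> span (g (Suc j + 2) \<union> R)"
      by (auto intro!: span_base br_mem_bracket_span)
    moreover have "br x (br y t) \<in> span (g (Suc j + 2) \<union> R)"
      using br_span_lower_central_Un_R[of "j + 2" "br y t" x] step.IH[OF t] by simp
    moreover have "br y (br x t) = br (br y x) t + br x (br y t)"
      by (simp add: br_br)
    ultimately show "br x t \<in> {t. br y t \<in> span (g (Suc j + 2) \<union> R)}"
      by (auto intro: span_add)
  qed (use step.hyps in auto)
  with step.prems show ?case by auto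
qed

end

section \<open>The complex structure and the complex hulls of the series\<close>

locale nilpotent_complex_lie_algebra = real_lie_algebra br
  for br :: "'a::real_vector \<Rightarrow> 'a \<Rightarrow> 'a" +
  fixes J :: "'a \<Rightarrow> 'a"
  assumes nilpotent: "nilpotent_lie br"
    and complex_structure: "integrable_complex_structure br J"
begin

lemma linear_J: "linear J"
  and J_J [simp]: "J (J x) = - x"
  and integrable: "br (J x) (J y) = br x y + J (br (J x) y) + J (br x (J y))"
  using complex_structure by (auto simp: integrable_complex_structure_def)

lemmas J_simps = linear_add[OF linear_J] linear_diff[OF linear_J] linear_neg[OF linear_J]
  linear_scale[OF linear_J]

text \<open>By \<open>K_least\<close> this is the smallest \<open>J\<close>-invariant subspace
  containing \<open>g k\<close>.\<close>

definition K :: "nat \<Rightarrow> 'a set" where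
  "K k = {a + J b | a b. a \<in> g k \<and> b \<in> g k}"

lemma K_I: "a \<in> g k \<Longrightarrow> b \<in> g k \<Longrightarrow> a + J b \<in> K k"
  by (auto simp: K_def)

lemma lower_central_subset_K: "g k \<subseteq> K k"
  using K_I[of _ k 0] subspace_0[OF subspace_lower_central] linear_0[OF linear_J] by fastforce

lemma J_lower_central_subset_K: "b \<in> g k \<Longrightarrow> J b \<in> K k"
  using K_I[of 0 k b] subspace_0[OF subspace_lower_central] by simp

lemma subspace_K: "subspace (K k)"
proof -
  have "K k = {x + y | x y. x \<in> g k \<and> y \<in> J ` g k}"
    by (auto simp: K_def)
  then show ?thesis
    using subspace_sums[OF subspace_lower_central
        linear_subspace_image[OF linear_J subspace_lower_central]] by simp
qed

lemma J_mem_K: "v \<in> K k \<Longrightarrow> J v \<in> K k"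
proof -
  assume "v \<in> K k"
  then obtain a b where ab: "v = a + J b" "a \<in> g k" "b \<in> g k"
    by (auto simp: K_def)
  then have "J v = - b + J a"
    by (simp add: J_simps)
  then show ?thesis
    using ab K_I[of "- b" k a] by (simp add: subspace_neg subspace_lower_central)
qed

lemma K_least:
  assumes "subspace V" "\<And>v. v \<in> V \<Longrightarrow> J v \<in> V" "g k \<subseteq> V"
  shows "K k \<subseteq> V"
  using assms by (auto simp: K_def intro!: subspace_add)

text \<open>After expansion, only \<open>br (J b) (J d)\<close> lacks a factor in
  \<open>g k\<close>; integrability rewrites it into terms that have one, up to an outer
  \<open>J\<close>.\<close>

lemma br_K:
  assumes "1 \<le> k" "v \<in> K k" "w \<in> K k"
  shows "br v w \<in> K (Suc k)"
proof -
  obtain a b where v: "v = a + J b" "a \<in> g k" "b \<in> g k"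
    using assms(2) by (auto simp: K_def)
  obtain c d where w: "w = c + J d" "c \<in> g k" "d \<in> g k"
    using assms(3) by (auto simp: K_def)
  have left: "br s y \<in> K (Suc k)" and right: "br y s \<in> K (Suc k)" if "s \<in> g k" for s y
    using that assms(1) br_mem_lower_central br_mem_lower_central' lower_central_subset_K by blast+
  have "br (J b) (J d) \<in> K (Suc k)"
    unfolding integrable using v(3) w(3)
    by (intro subspace_add subspace_K J_mem_K left right)
  moreover have "br v w = br a c + br a (J d) + br (J b) c + br (J b) (J d)"
    by (simp add: v w br_simps)
  ultimately show ?thesis
    using left[OF v(2)] right[OF w(2)] by (simp add: subspace_add subspace_K)
qed

text \<open>Integrability makes the operator commute with \<open>J\<close>, which reduces the claim
  to arguments in \<open>g k\<close>; there both brackets lie in \<open>g (Suc k)\<close>.\<close>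

lemma ad_plus_J_ad_J_mem_K:
  assumes "1 \<le> k" "v \<in> K k"
  shows "br x v + J (br (J x) v) \<in> K (Suc k)"
proof -
  obtain a b where v: "v = a + J b" "a \<in> g k" "b \<in> g k"
    using assms(2) by (auto simp: K_def)
  have "br x (J b) + J (br (J x) (J b)) = J (br x b + J (br (J x) b))"
    by (simp add: integrable J_simps)
  then have "br x v + J (br (J x) v) =
      (br x a + J (br (J x) a)) + J (br x b + J (br (J x) b))"
    by (simp add: v br_simps J_simps algebra_simps)
  moreover have "br x c + J (br (J x) c) \<in> K (Suc k)" if "c \<in> g k" for c
    using that assms(1) by (intro K_I br_mem_lower_central)
  ultimately show ?thesis
    using v(2,3) by (simp add: subspace_add subspace_K J_mem_K)
qed

lemma lower_central_eventually_0: "\<exists>n0\<ge>1. \<forall>n\<ge>n0. g n = {0}"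
proof -
  obtain n0 where n0: "n0 \<ge> 1" "g n0 = {0}"
    using nilpotent by (auto simp: nilpotent_lie_def)
  have "g n = {0}" if "n \<ge> n0" for n
    using lower_central_antimono[OF that] subspace_0[OF subspace_lower_central, of n] n0(2) by auto
  with n0(1) show ?thesis by auto
qed

lemma lower_central_stationary:
  assumes "1 \<le> k" "g k \<subseteq> g (Suc k)"
  shows "g k = {0}"
proof -
  have "g k \<subseteq> g n" if "k \<le> n" for n
    using that
  proof (induction n rule: dec_induct)
    case (step n)
    have "g (Suc k) \<subseteq> g (Suc n)"
      using assms(1) step by (intro lower_central_Suc_least subspace_lower_central)
        (auto intro!: br_mem_lower_central)
    with assms(2) show ?case by auto
  qed auto
  moreover obtain n0 where "\<forall>n\<ge>n0. g n = {0}"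
    using lower_central_eventually_0 by auto
  ultimately have "g k \<subseteq> {0}"
    by (metis max.cobounded1 max.cobounded2)
  then show ?thesis
    using subspace_0[OF subspace_lower_central, of k] by auto
qed

text \<open>\<open>K n\<close> vanishes with \<open>g n\<close> for large \<open>n\<close>. The two
  inductions that keep \<open>K n\<close> large are refuted through this lemma.\<close>

lemma K_stationary:
  assumes "\<And>n. m \<le> n \<Longrightarrow> K m \<subseteq> K n"
  shows "g m = {0}"
proof -
  obtain n0 where n0: "\<forall>n\<ge>n0. g n = {0}"
    using lower_central_eventually_0 by auto
  then have "K (max m n0) = {0}"
    by (auto simp: K_def linear_0[OF linear_J])
  then have "g m \<subseteq> {0}"
    using assms[of "max m n0"] lower_central_subset_K[of m] by auto
  then show ?thesis
    using subspace_0[OF subspace_lower_central, of m] by auto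
qed

text \<open>If \<open>K n\<close> is everything, then \<open>g 2\<close> consists of sums of
  brackets from \<open>K n\<close> and lies in \<open>K (Suc n)\<close> by \<open>br_K\<close>. So
  does its hull \<open>K 2\<close>, and if that is everything, the argument repeats forever.\<close>

lemma K_2_ne_UNIV:
  assumes "(UNIV :: 'a set) \<noteq> {0}"
  shows "K 2 \<noteq> UNIV"
proof
  assume K2: "K 2 = UNIV"
  have "K n = UNIV" if "1 \<le> n" for n
    using that
  proof (induction n rule: dec_induct)
    case base
    show ?case
      using lower_central_subset_K[of 1] by auto
  next
    case (step n)
    have "g (Suc 1) \<subseteq> K (Suc n)"
      using step br_K[of n] by (intro lower_central_Suc_least subspace_K) auto
    then have "K 2 \<subseteq> K (Suc n)"
      by (intro K_least subspace_K J_mem_K) (auto simp: numeral_2_eq_2)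
    with K2 show ?case by auto
  qed
  then have "g 1 = {0}"
    by (intro K_stationary) auto
  with assms show False by simp
qed

text \<open>A complex subspace has even codimension in another one.\<close>

lemma mem_of_J_mem_span_insert:
  assumes "subspace V" "\<And>v. v \<in> V \<Longrightarrow> J v \<in> V" "J z \<in> span (insert z V)"
  shows "z \<in> V"
proof -
  obtain c v where v: "J z = c *\<^sub>R z + v" "v \<in> V"
    using assms(1,3) by (rule span_insertE)
  \<comment> \<open>Modulo \<open>V\<close>, \<open>J\<close> multiplies \<open>z\<close> by the
    real scalar \<open>c\<close>; since \<open>J\<close> squares to -1, \<open>1 + c^2\<close>
    annihilates \<open>z\<close> modulo \<open>V\<close>.\<close>
  have "- z = J (c *\<^sub>R z + v)"
    by (metis v(1) J_J)
  also have "\<dots> = c *\<^sub>R (c *\<^sub>R z + v) + J v"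
    by (simp add: J_simps v(1))
  finally have z: "c *\<^sub>R (c *\<^sub>R z + v) + J v = - z" ..
  have "(1 + c\<^sup>2) *\<^sub>R z = z + (c *\<^sub>R (c *\<^sub>R z + v) + J v) - (c *\<^sub>R v + J v)"
    by (simp add: algebra_simps power2_eq_square)
  then have "(1 + c\<^sup>2) *\<^sub>R z = - (c *\<^sub>R v + J v)"
    unfolding z by simp
  moreover have "- (c *\<^sub>R v + J v) \<in> V"
    using assms(1,2) v(2) by (intro subspace_neg subspace_add subspace_scale) auto
  moreover have "1 + c\<^sup>2 \<noteq> 0"
    by (smt (verit) zero_le_power2)
  ultimately have "inverse (1 + c\<^sup>2) *\<^sub>R (1 + c\<^sup>2) *\<^sub>R z \<in> V" "1 + c\<^sup>2 \<noteq> 0"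
    using assms(1) by (simp_all only: subspace_scale not_False_eq_True)
  then show ?thesis
    by simp
qed

section \<open>Stationarity of the complex hulls\<close>

text \<open>This is the induction step for \<open>K k = g 2\<close>. A descending induction on
  \<open>j\<close> puts \<open>g j\<close> into \<open>K (Suc k)\<close>: brackets with
  \<open>J x\<close> skip an index modulo \<open>R\<close>, those with \<open>x\<close> follow by
  \<open>ad_plus_J_ad_J_mem_K\<close>, and those with \<open>g 2\<close> fall into
  \<open>R\<close>.\<close>

lemma K_Suc_eq_lower_central_2:
  assumes K2: "K 2 = g 2" and k: "3 \<le> k" "K k = g 2"
    and UNIV_eq: "UNIV = span (insert (J x) (insert x (g 2)))"
    and shift: "\<And>s. s \<in> g 2 \<Longrightarrow> br (J x) s \<in> g 4"
    and K3: "K 3 = g 2"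
  shows "K (Suc k) = g 2"
proof
  let ?L = "K (Suc k)"
  \<comment> \<open>Here \<open>g 2\<close> is \<open>K k\<close>, so \<open>br_K\<close> applies to
    the generators of \<open>R\<close>.\<close>
  have R_L: "R \<subseteq> ?L"
    unfolding bracket_span_def using k br_K[of k] by (intro span_minimal subspace_K) auto
  have descend: "g (Suc j) \<subseteq> ?L" if j: "2 \<le> j" and IH: "g (Suc (Suc j)) \<subseteq> ?L" for j
  proof (rule lower_central_Suc_least)
    fix y s
    assume s: "s \<in> g j"
    then have s2: "s \<in> g 2"
      using lower_central_antimono[OF j] by auto
    \<comment> \<open>The shift by two is what makes descent possible: this bracket lands in
      \<open>g (j + 2)\<close> modulo \<open>R\<close>, which is already known to lie in
      \<open>?L\<close>.\<close>
    have Jx: "br (J x) s \<in> ?L"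
    proof -
      have "g (j + 2) \<union> R \<subseteq> ?L"
        using R_L IH by simp
      then have "span (g (j + 2) \<union> R) \<subseteq> ?L"
        by (rule span_minimal[OF _ subspace_K])
      with br_shift_two[OF shift j s] show ?thesis by blast
    qed
    have "br x s + J (br (J x) s) \<in> ?L"
      using k s2 by (intro ad_plus_J_ad_J_mem_K) auto
    then have x: "br x s \<in> ?L"
      using subspace_diff[OF subspace_K _ J_mem_K[OF Jx], of "br x s + J (br (J x) s)"] by simp
    have "span (insert (J x) (insert x (g 2))) \<subseteq> {y. br y s \<in> ?L}"
    proof (rule span_minimal)
      show "subspace {y. br y s \<in> ?L}"
        by (intro subspace_br_left subspace_K)
      have "br p s \<in> ?L" if "p \<in> g 2" for p
        using R_L br_mem_bracket_span[OF that s2] by auto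
      with Jx x show "insert (J x) (insert x (g 2)) \<subseteq> {y. br y s \<in> ?L}"
        by auto
    qed
    with UNIV_eq show "br y s \<in> ?L"
      by auto
  qed (use j subspace_K in auto)
  obtain n0 where n0: "\<forall>n\<ge>n0. g n = {0}"
    using lower_central_eventually_0 by auto
  have "g 3 \<subseteq> ?L"
  \<comment> \<open>The induction descends from an index where \<open>g\<close> vanishes;
    \<open>max\<close> keeps it at least 3, so \<open>descend\<close> is always used at an index
    \<open>n - 1\<close> of at least 2.\<close>
  proof (rule inc_induct[of 3 "max 3 n0" "\<lambda>n. g n \<subseteq> ?L"])
    show "g (max 3 n0) \<subseteq> ?L"
      using n0 subspace_0[OF subspace_K] by simp
    fix n
    assume "3 \<le> n" "g (Suc n) \<subseteq> ?L"
    then show "g n \<subseteq> ?L"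
      using descend[of "n - 1"] by simp
  qed auto
  then have "K 3 \<subseteq> ?L"
    by (intro K_least subspace_K J_mem_K)
  with K3 show "g 2 \<subseteq> ?L" by simp
  have "g (Suc k) \<subseteq> K 2"
    using k(1) lower_central_antimono[of 2 "Suc k"] by (simp only: K2)
  then show "?L \<subseteq> g 2"
    unfolding K2[symmetric] by (intro K_least subspace_K J_mem_K)
qed

lemma lower_central_2_eq_0:
  assumes K2: "K 2 = g 2" and UNIV_eq: "UNIV = span (insert (J x) (insert x (g 2)))"
    and g2: "g 2 = span (insert z (g 3))" and xz: "br (J x) z \<in> g 4"
  shows "g 2 = {0}"
proof (rule ccontr)
  assume ne: "g 2 \<noteq> {0}"
  have "z \<in> g 2"
    unfolding g2 by (auto intro: span_base)
  \<comment> \<open>It suffices to check \<open>z\<close> and \<open>g 3\<close>, and on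
    \<open>g 3\<close> every bracket raises the index.\<close>
  have shift: "br (J x) s \<in> g 4" if s: "s \<in> g 2" for s
  proof -
    obtain c t where "s = c *\<^sub>R z + t" "t \<in> g 3"
      using subspace_lower_central s[unfolded g2] by (rule span_insertE)
    then show ?thesis
      using xz br_mem_lower_central[of 3 t "J x"]
      by (simp add: br_simps subspace_add subspace_scale subspace_lower_central)
  qed
  have sub: "K 3 \<subseteq> g 2"
    using lower_central_Suc_subset[of 2] unfolding K2[symmetric]
    by (intro K_least subspace_K J_mem_K) (auto simp: K2)
  have "K 3 = g 2"
  \<comment> \<open>\<open>K 3\<close> lies between \<open>g 3\<close> and its extension by the
    single vector \<open>z\<close>, so it equals one of them. Were it \<open>g 3\<close>, then
    \<open>g 3\<close> would be \<open>J\<close>-invariant and parity would put \<open>z\<close>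
    into it, stopping the series at \<open>g 2\<close>.\<close>
  proof (cases "K 3 \<subseteq> g 3")
    case True
    have "z \<in> g 3"
    proof (rule mem_of_J_mem_span_insert)
      show "J v \<in> g 3" if "v \<in> g 3" for v
        using True J_lower_central_subset_K[OF that] by auto
      show "J z \<in> span (insert z (g 3))"
        using J_mem_K[of z 2] \<open>z \<in> g 2\<close> unfolding K2 g2 .
    qed (rule subspace_lower_central)
    then have "g 2 \<subseteq> g (Suc 2)"
      unfolding g2 by (intro span_minimal) (auto simp: subspace_lower_central)
    with ne lower_central_stationary[of 2] show ?thesis by simp
  next
    case False
    then obtain v where v: "v \<in> K 3" "v \<notin> g 3" by auto
    have "v \<in> span (insert z (g 3))"
      using v(1) sub g2 by auto
    with subspace_lower_central obtain c t where ct: "v = c *\<^sub>R z + t" "t \<in> g 3"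
      by (rule span_insertE)
    with v(2) have "c \<noteq> 0" by auto
    have "v - t \<in> K 3"
      using v(1) ct(2) lower_central_subset_K by (intro subspace_diff subspace_K) auto
    then have "inverse c *\<^sub>R (v - t) \<in> K 3"
      by (intro subspace_scale subspace_K)
    then have "z \<in> K 3"
      using ct \<open>c \<noteq> 0\<close> by simp
    then have "g 2 \<subseteq> K 3"
      unfolding g2 using lower_central_subset_K by (intro span_minimal subspace_K) auto
    with sub show ?thesis by auto
  qed
  have "K n = g 2" if "3 \<le> n" for n
    using that
  proof (induction n rule: dec_induct)
    case base
    show ?case by fact
  next
    case (step n)
    then show ?case
      using \<open>K 3 = g 2\<close> K_Suc_eq_lower_central_2[OF K2 _ _ UNIV_eq shift] by auto
  qed
  then have "K 3 \<subseteq> K n" if "3 \<le> n" for n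
    using that by auto
  then have "g 3 = {0}"
    by (rule K_stationary)
  then show False
    using ne \<open>K 3 = g 2\<close> by (auto simp: K_def linear_0[OF linear_J])
qed

section \<open>The dimension count\<close>

text \<open>Both extensions are proper, the second one by parity. The inner \<open>span\<close> lets
  \<open>dim_insert_finite_dimensional\<close> apply twice.\<close>

lemma dim_span_insert_J:
  assumes "subspace V" "\<And>v. v \<in> V \<Longrightarrow> J v \<in> V" "z \<notin> V" "finite_dimensional TYPE('a)"
  shows "dim (span (insert (J z) (span (insert z V)))) = dim V + 2"
proof -
  have "J z \<notin> span (insert z V)"
    using mem_of_J_mem_span_insert assms(1-3) by blast
  then show ?thesis
    using dim_insert_finite_dimensional[OF assms(4,1,3)]
      dim_insert_finite_dimensional[OF assms(4) subspace_span, of "J z" "insert z V"] by simp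
qed

text \<open>Modulo \<open>g 4\<close>, bracketing with \<open>z\<close> maps the plane of
  \<open>x\<close> and \<open>J x\<close> to the line of \<open>w\<close>, so it kills a nonzero
  vector of that plane; \<open>J y\<close> is this vector.\<close>

lemma exists_shifting_direction:
  assumes J_g2: "\<And>v. v \<in> g 2 \<Longrightarrow> J v \<in> g 2" and g3: "g 3 = span (insert w (g 4))"
    and z: "z \<in> g 2" and x: "x \<notin> g 2"
  obtains y where "y \<notin> g 2" "br (J y) z \<in> g 4"
proof -
  have bz: "br u z \<in> span (insert w (g 4))" for u
    unfolding g3[symmetric] using br_mem_lower_central[of 2 z u] z by simp
  obtain a s where a: "br x z = a *\<^sub>R w + s" "s \<in> g 4"
    using subspace_lower_central bz by (rule span_insertE)
  obtain b t where b: "br (J x) z = b *\<^sub>R w + t" "t \<in> g 4"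
    using subspace_lower_central bz by (rule span_insertE)
  show thesis
  proof (cases "a = 0 \<and> b = 0")
    case True
    with b x show thesis by (intro that[of x]) auto
  next
    case False
    \<comment> \<open>The coefficients make the two multiples of \<open>w\<close> in
      \<open>br (J y) z\<close> cancel. Recovering a nonzero multiple of \<open>x\<close> from
      \<open>y\<close> and \<open>J y\<close> shows that \<open>y\<close> is outside the
      \<open>J\<close>-invariant \<open>g 2\<close>.\<close>
    define y where "y = a *\<^sub>R x + b *\<^sub>R J x"
    have Jy: "J y = a *\<^sub>R J x - b *\<^sub>R x"
      by (simp add: y_def J_simps)
    have "y \<notin> g 2"
    proof
      assume "y \<in> g 2"
      then have "a *\<^sub>R y - b *\<^sub>R J y \<in> g 2"
        using J_g2 by (intro subspace_diff subspace_scale subspace_lower_central)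
      moreover have "a *\<^sub>R y - b *\<^sub>R J y = (a\<^sup>2 + b\<^sup>2) *\<^sub>R x"
        by (simp add: Jy) (simp add: y_def algebra_simps power2_eq_square)
      ultimately have "inverse (a\<^sup>2 + b\<^sup>2) *\<^sub>R (a\<^sup>2 + b\<^sup>2) *\<^sub>R x \<in> g 2"
        by (simp only: subspace_scale subspace_lower_central)
      moreover have "a\<^sup>2 + b\<^sup>2 \<noteq> 0"
        using False by (simp add: sum_power2_eq_zero_iff)
      ultimately show False
        using x by simp
    qed
    moreover have "br (J y) z = a *\<^sub>R t - b *\<^sub>R s"
      by (simp add: Jy br_simps a b algebra_simps)
    then have "br (J y) z \<in> g 4"
      using a(2) b(2) by (simp add: subspace_diff subspace_scale subspace_lower_central)
    ultimately show thesis by (rule that)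
  qed
qed

lemma dim_lower_central_4:
  assumes fd: "finite_dimensional TYPE('a)" and dim: "dim (UNIV :: 'a set) \<ge> 6"
  shows "dim (g 4) + 5 \<le> dim (UNIV :: 'a set)"
proof (rule ccontr)
  assume "\<not> ?thesis"
  then have small: "dim (UNIV :: 'a set) \<le> dim (g 4) + 4"
    by simp
  \<comment> \<open>This is where dimension at least 6 enters: codimension at most 4 leaves
    \<open>g 4\<close> nonzero, so nilpotency makes the series drop strictly up to there.\<close>
  have g4: "g 4 \<noteq> {0}"
  proof
    assume "g 4 = {0}"
    then have "dim (g 4) = 0"
      using basis_card_eq_dim[of "{}" "g 4"] by (simp add: independent_empty)
    with small dim show False by linarith
  qed
  have ne: "g k \<noteq> {0}" if "k \<le> 4" for k
  proof
    assume "g k = {0}"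
    then have "g 4 \<subseteq> {0}"
      using lower_central_antimono[OF that] by simp
    with g4 subspace_0[OF subspace_lower_central, of 4] show False by blast
  qed
  have strict': "g (Suc k) \<subset> g k" if "1 \<le> k" "k \<le> 4" for k
    using lower_central_Suc_subset[of k] lower_central_stationary[OF that(1)] ne[OF that(2)] by blast
  have strict: "g 3 \<subset> g 2" "g 4 \<subset> g 3"
    using strict'[of 2] strict'[of 3] by simp_all
  have less: "dim (g i) < dim (g j)" if "g i \<subset> g j" for i j
  proof (rule ccontr)
    assume "\<not> ?thesis"
    then have "g i = g j"
      using that by (intro subspace_dim_equal_finite_dimensional[OF fd] subspace_lower_central) auto
    with that show False by simp
  qed
  have dim_UNIV: "dim V + 2 \<le> dim (UNIV :: 'a set)"
    if "subspace V" "\<And>v. v \<in> V \<Longrightarrow> J v \<in> V" "z \<notin> V" for V z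
    using dim_span_insert_J[OF that fd]
      dim_subset_finite_dimensional[OF fd subset_UNIV, of "span (insert (J z) (span (insert z V)))"]
    by simp
  have "(UNIV :: 'a set) \<noteq> {0}"
    using g4 ne[of 1] by simp
  then obtain x0 where "x0 \<notin> K 2"
    using K_2_ne_UNIV by auto
  then have "dim (K 2) + 2 \<le> dim (UNIV :: 'a set)"
    by (intro dim_UNIV[of "K 2" x0] subspace_K J_mem_K)
  moreover have "dim (g 2) \<le> dim (K 2)"
    by (intro dim_subset_finite_dimensional fd lower_central_subset_K)
  moreover have "dim (g 3) < dim (g 2)" "dim (g 4) < dim (g 3)"
    using strict by (auto intro: less)
  \<comment> \<open>The drops are at least 2 from the whole algebra to \<open>K 2\<close>, 1 from
    \<open>g 2\<close> to \<open>g 3\<close> and 1 from \<open>g 3\<close> to \<open>g 4\<close>.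
    The total is at most 4, so all are exact and \<open>K 2\<close> is no larger than
    \<open>g 2\<close>.\<close>
  ultimately have dims: "dim (K 2) \<le> dim (g 2)" "dim (UNIV :: 'a set) \<le> dim (g 2) + 2"
    "dim (g 2) \<le> dim (g 3) + 1" "dim (g 3) \<le> dim (g 4) + 1"
    using small by linarith+
  have K2: "K 2 = g 2"
    using subspace_dim_equal_finite_dimensional[OF fd subspace_lower_central subspace_K
        lower_central_subset_K dims(1)] by simp
  have J_g2: "J v \<in> g 2" if "v \<in> g 2" for v
    using that J_mem_K[of v 2] unfolding K2 by blast
  obtain z where z: "z \<in> g 2" "g 2 = span (insert z (g 3))"
    using subspace_eq_span_insert[OF fd subspace_lower_central subspace_lower_central _ dims(3)]
      strict(1) by metis
  obtain w where w: "g 3 = span (insert w (g 4))"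
    using subspace_eq_span_insert[OF fd subspace_lower_central subspace_lower_central _ dims(4)]
      strict(2) by metis
  obtain x where x: "x \<notin> g 2" "br (J x) z \<in> g 4"
    using exists_shifting_direction[OF J_g2 w z(1), of x0] \<open>x0 \<notin> K 2\<close> unfolding K2 by blast
  \<comment> \<open>The right side has dimension \<open>dim (g 2) + 2\<close>, which already reaches
    that of the whole space.\<close>
  have "UNIV = span (insert (J x) (span (insert x (g 2))))"
    using dim_span_insert_J[OF subspace_lower_central J_g2 x(1) fd] dims(2)
    by (intro subspace_dim_equal_finite_dimensional[OF fd, symmetric]) auto
  then have "UNIV = span (insert (J x) (insert x (g 2)))"
    by (simp only: span_insert[of "J x"] span_span)
  then have "g 2 = {0}"
    using lower_central_2_eq_0[OF K2 _ z(2) x(2)] by simp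
  with ne[of 2] show False by simp
qed

end

theorem proposition4p6:
  fixes br :: "'a::real_vector \<Rightarrow> 'a \<Rightarrow> 'a" and J :: "'a \<Rightarrow> 'a"
  assumes "finite_dimensional TYPE('a)"
    and "real_lie_algebra br"
    and "nilpotent_lie br"
    and "integrable_complex_structure br J"
    and "dim (UNIV :: 'a set) \<ge> 6"
  shows "int (dim (UNIV :: 'a set)) - int (dim (lower_central br 4))
           = int (dim (UNIV :: 'a set))
             - int (dim (bracket_span br UNIV (bracket_span br UNIV (bracket_span br UNIV UNIV))))
       \<and> int (dim (UNIV :: 'a set)) - int (dim (lower_central br 4)) \<ge> 5"
proof -
  interpret nilpotent_complex_lie_algebra br J
    using assms(2-4) by (simp add: nilpotent_complex_lie_algebra_def
        nilpotent_complex_lie_algebra_axioms_def)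
  have "lower_central br 4 = bracket_span br UNIV (bracket_span br UNIV (bracket_span br UNIV UNIV))"
    by (simp add: eval_nat_numeral)
  moreover have "dim (lower_central br 4) + 5 \<le> dim (UNIV :: 'a set)"
    using assms(1,5) by (rule dim_lower_central_4)
  ultimately show ?thesis
    by simp
qed

end
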